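(* For a symmetric two-hop network with $P_r^i=P_r$, $N_r^i=N_r$, $h_i=c$ for all $i=1,\dots,L$, $h=0$, $\beta=1$, the gap between the necessary and sufficient conditions for mean square stability approaches zero as the number of relays $L$ goes to infinity. The gap also monotonically approaches zero as $P_r$ goes to infinity.
   Context: $\log$ is base 2. Half-duplex network with $L$ relays: a state encoder observes a linear plant with system matrix $A$ ($A=\lambda$ in the scalar case). In odd time steps the encoder transmits with average power $2\beta P_S$ and relay $i$ receives this signal plus Gaussian noise of variance $N_r^i$, while the relays are silent; in even time steps the encoder transmits with average power $2(1-\beta)P_S$ and relay $i$ with average power $2P_r^i$, $\sum_{i=1}^LP_r^i\le P_R$. The remote controller receives the encoder signal scaled by the channel gain $h\in\mathbb R$, plus the relay signals scaled by the gains $h_i\in\mathbb R$, plus Gaussian noise of variance $N_d$. All noises are white and mutually independent. The two-hop network is the case $h=0$: the state information reaches the controller only via the relays. Mean square stability means that the second moment of the state is uniformly bounded in time. The necessary condition for the two-hop network is an upper bound on $\log|\det A|$ that is a minimum of two terms, each maximized over the power-splitting parameter $\beta$ (the first term is maximized at $\beta=1$, the second at $\beta=0$, and the second also over the relay powers $P_r^i$). For the symmetric network (total relay power $P_R=LP_r$, equal relay powers being optimal) it reads $$\log|\det A|\le\frac14\min\left\{\log\left(1+\frac{2LP_S}{N_r}\right),\ \log\left(1+\frac{2Lc^2P_r}{N_d}\left(1+(L-1)\frac{2P_S}{2P_S+N_r}\right)\right)\right\}.$$ The sufficient condition for mean square stabilization of the scalar plant by a linear scheme over the symmetric two-hop network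 ($h=0$, $\beta=1$) is $$\log|\lambda|<\frac14\log\left(1+\frac{4L^2c^2P_SP_r}{2Lc^2P_rN_r+N_d(2P_S+N_r)}\right).$$ The gap is the right-hand side of the necessary condition minus the right-hand side of the sufficient condition. In each limit the remaining parameters among $P_S,P_r,N_r,N_d,c,L$ are held fixed.
   Formalization: "Monotonically approaches zero" is stated as: the gap tends to zero and is non-increasing for all sufficiently large P_r; over all P_r > 0 it is false, since for c ≠ 0 and P_S > 0 the gap vanishes at P_r = 0 and first increases. *)

theory Defs
  imports Complex_Main
begin

text \<open>
  Right-hand sides of the two stability conditions for the symmetric two-hop network
  (no direct link, all transmit power of the encoder in the odd steps). Arguments: number
  of relays \<open>L\<close>, encoder power \<open>P\<^sub>S\<close>, power \<open>P\<^sub>r\<close> of each single relay, relay noise variance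
  \<open>N\<^sub>r\<close>, controller noise variance \<open>N\<^sub>d\<close>, relay-to-controller gain \<open>c\<close>. The total relay
  power is \<open>L * P\<^sub>r\<close>, so it grows with \<open>L\<close> when \<open>P\<^sub>r\<close> is held fixed.
\<close>

definition necessary_rhs :: "nat \<Rightarrow> real \<Rightarrow> real \<Rightarrow> real \<Rightarrow> real \<Rightarrow> real \<Rightarrow> real" where
  "necessary_rhs L P\<^sub>S P\<^sub>r N\<^sub>r N\<^sub>d c =
     1 / 4 * min (log 2 (1 + 2 * real L * P\<^sub>S / N\<^sub>r))
                 (log 2 (1 + 2 * real L * c\<^sup>2 * P\<^sub>r / N\<^sub>d
                             * (1 + (real L - 1) * (2 * P\<^sub>S / (2 * P\<^sub>S + N\<^sub>r)))))"

definition sufficient_rhs :: "nat \<Rightarrow> real \<Rightarrow> real \<Rightarrow> real \<Rightarrow> real \<Rightarrow> real \<Rightarrow> real" where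
  "sufficient_rhs L P\<^sub>S P\<^sub>r N\<^sub>r N\<^sub>d c =
     1 / 4 * log 2 (1 + 4 * (real L)\<^sup>2 * c\<^sup>2 * P\<^sub>S * P\<^sub>r
                        / (2 * real L * c\<^sup>2 * P\<^sub>r * N\<^sub>r + N\<^sub>d * (2 * P\<^sub>S + N\<^sub>r)))"

text \<open>
  As a function of \<open>P\<^sub>r\<close> the gap is not monotone on all of \<open>[0, \<infinity>)\<close>: it vanishes at \<open>P\<^sub>r = 0\<close>
  and, for \<open>P\<^sub>S > 0\<close> and \<open>c \<noteq> 0\<close>, grows as long as the second term of the minimum is the
  smaller one. Monotone convergence for \<open>P\<^sub>r \<rightarrow> \<infinity>\<close> can therefore only mean monotonicity for
  all sufficiently large \<open>P\<^sub>r\<close>.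
\<close>

definition gap :: "nat \<Rightarrow> real \<Rightarrow> real \<Rightarrow> real \<Rightarrow> real \<Rightarrow> real \<Rightarrow> real" where
  "gap L P\<^sub>S P\<^sub>r N\<^sub>r N\<^sub>d c = necessary_rhs L P\<^sub>S P\<^sub>r N\<^sub>r N\<^sub>d c - sufficient_rhs L P\<^sub>S P\<^sub>r N\<^sub>r N\<^sub>d c"

end

(* With X = 2 L P_S / N_r and u = 2 L c^2 P_r N_r / (N_d (2 P_S + N_r)), the two terms of the
   necessary condition are log (1 + X) and log (1 + u (1 + X)), and the sufficient one is
   log ((1 + u (1 + X)) / (1 + u)). Hence four times the gap is
   min (log (1 + u)) (log (1 + X / (1 + u (1 + X)))). The second term is antitone in u, at most
   log (1 + 1/u) uniformly in X, and the smaller one as soon as u \<ge> 1. Unless u vanishes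
   identically (and the gap with it), u tends to infinity with L and with P_r. *)
theory Submission
  imports Defs
begin

text \<open>\<open>X\<close> varies with the number of relays only, while \<open>u\<close> carries
  all dependence on the relay power. Both limits thus become statements about large
  \<open>u\<close>.\<close>

definition reduced_gap :: "real \<Rightarrow> real \<Rightarrow> real" where
  "reduced_gap X u = 1 / 4 * min (log 2 (1 + u)) (log 2 (1 + X / (1 + u * (1 + X))))"

lemma reduced_gap_0: "X \<ge> 0 \<Longrightarrow> reduced_gap X 0 = 0"
  by (simp add: reduced_gap_def)

lemma reduced_gap_nonneg:
  assumes "X \<ge> 0" "u \<ge> 0"
  shows "reduced_gap X u \<ge> 0"
proof -
  have "X / (1 + u * (1 + X)) \<ge> 0"
    using assms by simp
  then have "log 2 (1 + X / (1 + u * (1 + X))) \<ge> 0"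
    by (subst zero_le_log_cancel_iff) auto
  then show ?thesis
    using assms by (simp add: reduced_gap_def)
qed

text \<open>Clearing denominators leaves \<open>u * X \<le> 1 + u + u * X\<close>. The bound is free
  of \<open>X\<close>, which matters because \<open>X\<close> itself grows with the number of
  relays.\<close>

lemma log_quotient_le:
  assumes "X \<ge> 0" "u > 0"
  shows "log 2 (1 + X / (1 + u * (1 + X))) \<le> log 2 (1 + 1 / u)"
proof -
  have "1 + u * (1 + X) > 0"
    using assms by (intro add_pos_nonneg) auto
  then have "X / (1 + u * (1 + X)) \<le> 1 / u"
    using assms by (simp add: divide_simps algebra_simps)
  moreover have "X / (1 + u * (1 + X)) \<ge> 0"
    using assms by simp
  ultimately show ?thesis
    using assms by (subst log_le_cancel_iff) (auto intro: add_pos_nonneg)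
qed

lemma reduced_gap_le:
  assumes "X \<ge> 0" "u > 0"
  shows "reduced_gap X u \<le> 1 / 4 * log 2 (1 + 1 / u)"
  using log_quotient_le[OF assms] by (simp add: reduced_gap_def min_le_iff_disj)

text \<open>For \<open>u < 1\<close> the increasing term \<open>log 2 (1 + u)\<close> can be the
  minimum, hence the threshold. The minimum has to be identified at \<open>u\<close> only; at
  \<open>v\<close> it is merely bounded by its second term.\<close>

lemma reduced_gap_antimono:
  assumes "X \<ge> 0" "1 \<le> u" "u \<le> v"
  shows "reduced_gap X v \<le> reduced_gap X u"
proof -
  have pos: "1 + u * (1 + X) > 0" "1 + v * (1 + X) > 0"
    using assms by (auto intro!: add_pos_nonneg)
  have "X / (1 + v * (1 + X)) \<le> X / (1 + u * (1 + X))"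
    using assms pos by (intro divide_left_mono mult_pos_pos) (auto intro: mult_right_mono)
  moreover have "X / (1 + v * (1 + X)) \<ge> 0"
    using assms by simp
  ultimately have le: "log 2 (1 + X / (1 + v * (1 + X))) \<le> log 2 (1 + X / (1 + u * (1 + X)))"
    by (subst log_le_cancel_iff) auto
  have "1 / u \<le> 1"
    using assms by simp
  with assms have "1 / u \<le> u"
    by linarith
  then have "log 2 (1 + 1 / u) \<le> log 2 (1 + u)"
    using assms by (subst log_le_cancel_iff) (auto intro: add_pos_nonneg)
  with le log_quotient_le[of X u] assms show ?thesis
    by (simp add: reduced_gap_def)
qed

text \<open>A squeeze between 0 and a bound depending on \<open>u\<close> alone, so \<open>X\<close>
  may stay constant or diverge along the filter.\<close>

lemma tendsto_reduced_gap:
  assumes "\<forall>\<^sub>F t in F. X t \<ge> 0" and u: "filterlim u at_top F"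
  shows "((\<lambda>t. reduced_gap (X t) (u t)) \<longlongrightarrow> 0) F"
proof (rule tendsto_sandwich)
  have pos: "\<forall>\<^sub>F t in F. X t \<ge> 0 \<and> u t > 0"
    using assms(1) u by (auto simp: filterlim_at_top_dense eventually_conj_iff)
  show "\<forall>\<^sub>F t in F. 0 \<le> reduced_gap (X t) (u t)"
    using pos by eventually_elim (simp add: reduced_gap_nonneg)
  show "\<forall>\<^sub>F t in F. reduced_gap (X t) (u t) \<le> 1 / 4 * log 2 (1 + 1 / u t)"
    using pos by eventually_elim (simp add: reduced_gap_le del: times_divide_eq_left)
  have "((\<lambda>t. 1 / u t) \<longlongrightarrow> 0) F"
    using u by (intro real_tendsto_divide_at_top[OF tendsto_const])
  then have "((\<lambda>t. 1 / 4 * log 2 (1 + 1 / u t)) \<longlongrightarrow> 1 / 4 * log 2 (1 + 0)) F"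
    by (intro tendsto_intros) auto
  then show "((\<lambda>t. 1 / 4 * log 2 (1 + 1 / u t)) \<longlongrightarrow> 0) F"
    by simp
qed auto

lemma gap_eq_reduced_gap:
  fixes P\<^sub>S P\<^sub>r N\<^sub>r N\<^sub>d c :: real
  assumes "P\<^sub>S \<ge> 0" "P\<^sub>r \<ge> 0" "N\<^sub>r > 0" "N\<^sub>d > 0"
  shows "gap L P\<^sub>S P\<^sub>r N\<^sub>r N\<^sub>d c =
    reduced_gap (2 * P\<^sub>S / N\<^sub>r * real L) (2 * c\<^sup>2 * N\<^sub>r / (N\<^sub>d * (2 * P\<^sub>S + N\<^sub>r)) * real L * P\<^sub>r)"
proof -
  define X where "X = 2 * P\<^sub>S / N\<^sub>r * real L"
  define D where "D = 2 * P\<^sub>S + N\<^sub>r"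
  define u where "u = 2 * c\<^sup>2 * N\<^sub>r / (N\<^sub>d * D) * real L * P\<^sub>r"
  define B where "B = 1 + u * (1 + X)"
  have D: "D > 0"
    using assms by (simp add: D_def)
  have X: "X \<ge> 0" and u: "u \<ge> 0"
    using assms D by (simp_all add: X_def u_def)
  have B: "B > 0"
    using X u by (simp add: B_def add_pos_nonneg)
  \<comment> \<open>Over the common denominator \<open>D\<close> the numerator is
    \<open>D - 2 * P\<^sub>S + 2 * real L * P\<^sub>S\<close>, and
    \<open>D - 2 * P\<^sub>S = N\<^sub>r\<close>.\<close>
  have "1 + (real L - 1) * (2 * P\<^sub>S / D) = N\<^sub>r / D * (1 + X)"
    using assms D by (simp add: X_def field_simps) (simp add: D_def algebra_simps)
  then have "2 * real L * c\<^sup>2 * P\<^sub>r / N\<^sub>d * (1 + (real L - 1) * (2 * P\<^sub>S / D)) = u * (1 + X)"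
    using assms D by (simp add: u_def)
  then have nec: "necessary_rhs L P\<^sub>S P\<^sub>r N\<^sub>r N\<^sub>d c = 1 / 4 * min (log 2 (1 + X)) (log 2 B)"
    by (simp add: necessary_rhs_def B_def D_def X_def mult_ac)
  \<comment> \<open>The factor \<open>N\<^sub>d * D\<close> is split off here and in
    \<open>num\<close> so that it cancels in the quotient.\<close>
  have den: "2 * real L * c\<^sup>2 * P\<^sub>r * N\<^sub>r + N\<^sub>d * D = N\<^sub>d * D * (1 + u)"
    using assms D by (simp add: u_def field_simps)
  have num: "4 * (real L)\<^sup>2 * c\<^sup>2 * P\<^sub>S * P\<^sub>r = N\<^sub>d * D * (X * u)"
    using assms D by (simp add: u_def X_def power2_eq_square)
  \<comment> \<open>After cancellation this is \<open>1 + X * u / (1 + u)\<close>, and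
    \<open>B = (1 + u) + X * u\<close>.\<close>
  have "1 + 4 * (real L)\<^sup>2 * c\<^sup>2 * P\<^sub>S * P\<^sub>r / (2 * real L * c\<^sup>2 * P\<^sub>r * N\<^sub>r + N\<^sub>d * D) = B / (1 + u)"
    unfolding num den using assms D u by (simp add: B_def add_divide_eq_iff) (simp add: algebra_simps)
  then have suf: "sufficient_rhs L P\<^sub>S P\<^sub>r N\<^sub>r N\<^sub>d c = 1 / 4 * (log 2 B - log 2 (1 + u))"
    using B u by (simp add: sufficient_rhs_def D_def log_divide)
  \<comment> \<open>Here \<open>B + X\<close> factors as \<open>(1 + X) * (1 + u)\<close>.\<close>
  have "1 + X / B = (1 + X) * (1 + u) / B"
    using B by (simp add: field_simps) (simp add: B_def algebra_simps)
  then have "log 2 (1 + X / B) = log 2 (1 + X) + log 2 (1 + u) - log 2 B"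
    using B X u by (simp add: log_divide log_mult)
  \<comment> \<open>Subtracting the sufficient bound shifts both arguments of \<open>min\<close>;
    they appear in swapped order, \<open>log 2 B\<close> giving
    \<open>log 2 (1 + u)\<close>.\<close>
  then have "gap L P\<^sub>S P\<^sub>r N\<^sub>r N\<^sub>d c = 1 / 4 * min (log 2 (1 + u)) (log 2 (1 + X / B))"
    unfolding gap_def nec suf min_def by argo
  then show ?thesis
    by (simp add: reduced_gap_def B_def X_def u_def D_def)
qed

theorem proposition5p1:
  fixes P\<^sub>S N\<^sub>r N\<^sub>d c :: real
  assumes "P\<^sub>S \<ge> 0" and "N\<^sub>r > 0" and "N\<^sub>d > 0"
  shows "(\<forall>P\<^sub>r\<ge>0. (\<lambda>L. gap L P\<^sub>S P\<^sub>r N\<^sub>r N\<^sub>d c) \<longlonglongrightarrow> 0) \<and>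
         (\<forall>L\<ge>1. ((\<lambda>P\<^sub>r. gap L P\<^sub>S P\<^sub>r N\<^sub>r N\<^sub>d c) \<longlongrightarrow> 0) at_top \<and>
                (\<exists>p\<ge>0. antimono_on {p..} (\<lambda>P\<^sub>r. gap L P\<^sub>S P\<^sub>r N\<^sub>r N\<^sub>d c)))"
proof -
  define a where "a = 2 * P\<^sub>S / N\<^sub>r"
  define k where "k = 2 * c\<^sup>2 * N\<^sub>r / (N\<^sub>d * (2 * P\<^sub>S + N\<^sub>r))"
  have a: "a \<ge> 0" and k: "k \<ge> 0"
    using assms by (simp_all add: a_def k_def)
  have gap: "gap L P\<^sub>S P\<^sub>r N\<^sub>r N\<^sub>d c = reduced_gap (a * real L) (k * real L * P\<^sub>r)"
    if "P\<^sub>r \<ge> 0" for L P\<^sub>r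
    using assms that by (simp add: gap_eq_reduced_gap a_def k_def)
  have lim_L: "(\<lambda>L. gap L P\<^sub>S P\<^sub>r N\<^sub>r N\<^sub>d c) \<longlonglongrightarrow> 0" if "P\<^sub>r \<ge> 0" for P\<^sub>r
  \<comment> \<open>The product vanishes exactly when \<open>c = 0\<close> or
    \<open>P\<^sub>r = 0\<close>: nothing reaches the controller, and the gap is 0 for every
    \<open>L\<close>.\<close>
  proof (cases "k * P\<^sub>r = 0")
    case True
    then have "gap L P\<^sub>S P\<^sub>r N\<^sub>r N\<^sub>d c = 0" for L
      using a that by (auto simp: gap reduced_gap_0)
    then show ?thesis
      by simp
  next
    case False
    then have "k * P\<^sub>r > 0"
      using k that by (simp add: less_le)
    then have "LIM L sequentially. k * P\<^sub>r * real L :> at_top"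
      by (intro filterlim_tendsto_pos_mult_at_top[OF tendsto_const] filterlim_real_sequentially)
    then have "(\<lambda>L. reduced_gap (a * real L) (k * real L * P\<^sub>r)) \<longlonglongrightarrow> 0"
      using a by (intro tendsto_reduced_gap) (simp_all add: mult_ac)
    then show ?thesis
      using that by (simp add: gap)
  qed
  have lim_P: "((\<lambda>P\<^sub>r. gap L P\<^sub>S P\<^sub>r N\<^sub>r N\<^sub>d c) \<longlongrightarrow> 0) at_top \<and>
      (\<exists>p\<ge>0. antimono_on {p..} (\<lambda>P\<^sub>r. gap L P\<^sub>S P\<^sub>r N\<^sub>r N\<^sub>d c))" if "L \<ge> 1" for L
  proof (cases "k = 0")
    case True
    then have zero: "gap L P\<^sub>S P\<^sub>r N\<^sub>r N\<^sub>d c = 0" if "P\<^sub>r \<ge> 0" for P\<^sub>r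
      using a that by (simp add: gap reduced_gap_0)
    have "((\<lambda>P\<^sub>r. gap L P\<^sub>S P\<^sub>r N\<^sub>r N\<^sub>d c) \<longlongrightarrow> 0) at_top"
      \<comment> \<open>The reduction to \<open>reduced_gap\<close> holds for nonnegative power
        only, so equality with 0 is claimed eventually.\<close>
      by (rule tendsto_eventually) (use eventually_ge_at_top[of 0] in eventually_elim, simp add: zero)
    moreover have "antimono_on {0..} (\<lambda>P\<^sub>r. gap L P\<^sub>S P\<^sub>r N\<^sub>r N\<^sub>d c)"
      by (rule monotone_onI) (simp add: zero)
    ultimately show ?thesis
      by blast
  next
    case False
    then have kL: "k * real L > 0"
      using k that by simp
    then have "LIM P at_top. k * real L * P :> at_top"
      by (intro filterlim_tendsto_pos_mult_at_top[OF tendsto_const] filterlim_ident)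
    then have "((\<lambda>P. reduced_gap (a * real L) (k * real L * P)) \<longlongrightarrow> 0) at_top"
      using a by (intro tendsto_reduced_gap) simp_all
    moreover have "\<forall>\<^sub>F P in at_top.
        reduced_gap (a * real L) (k * real L * P) = gap L P\<^sub>S P N\<^sub>r N\<^sub>d c"
      using eventually_ge_at_top[of 0] by eventually_elim (simp add: gap)
    ultimately have lim: "((\<lambda>P\<^sub>r. gap L P\<^sub>S P\<^sub>r N\<^sub>r N\<^sub>d c) \<longlongrightarrow> 0) at_top"
      by (rule Lim_transform_eventually)
    \<comment> \<open>The relay power at which \<open>u = 1\<close>, the threshold in
      \<open>reduced_gap_antimono\<close>.\<close>
    define p where "p = 1 / (k * real L)"
    have p: "p \<ge> 0"
      using kL by (simp add: p_def)
    have "antimono_on {p..} (\<lambda>P\<^sub>r. gap L P\<^sub>S P\<^sub>r N\<^sub>r N\<^sub>d c)"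
    proof (rule monotone_onI)
      fix x y assume xy: "x \<in> {p..}" "y \<in> {p..}" "x \<le> y"
      then have "1 \<le> k * real L * x"
        using kL by (simp add: p_def pos_divide_le_eq mult_ac)
      moreover have "k * real L * x \<le> k * real L * y"
        using kL xy by (intro mult_left_mono) auto
      ultimately show "gap L P\<^sub>S y N\<^sub>r N\<^sub>d c \<le> gap L P\<^sub>S x N\<^sub>r N\<^sub>d c"
        using a p xy by (simp add: gap reduced_gap_antimono)
    qed
    with lim p show ?thesis
      by blast
  qed
  from lim_L lim_P show ?thesis
    by blast
qed

end
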